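(* Let $\varphi_1\colon 2^{S_1}\to\mathbb{R}$ denote the rank function of $M(K_4)$, the graphic matroid of the complete graph on four vertices, and let $\varphi_2\colon 2^{S_2}\to\mathbb{R}$ be a polymatroid function. If $\varphi_1$ and $\varphi_2$ have a tensor product $\varphi\colon 2^{S_1\times S_2}\to\mathbb{R}$, then $$\begin{aligned} &\sum_{i=1}^3\bigl(2\varphi_2(A_{i+1}A_{i+2}B_{i+1}B_{i+2}C_i)+\varphi_2(A_iD)+\varphi_2(B_iD)+\varphi_2(C_i)\bigr)\\ &\quad+\varphi_2(C_2)+\varphi_2(A_3B_3C_1)+\varphi_2(A_1A_2B_1B_2)+\varphi_2(C_1C_2C_3)\\ \le\ &2\sum_{i=1}^3\bigl(\varphi_2(A_{i+1}A_{i+2}C_i)+\varphi_2(B_{i+1}B_{i+2}C_i)+\varphi_2(A_iB_iD)\bigr)+\varphi_2(C_1C_2)+4\varphi_2(D) \end{aligned}$$ holds for all sets $A_1,A_2,A_3,B_1,B_2,B_3,C_1,C_2,C_3,D\subseteq S_2$, where juxtaposition of sets denotes their union and the indices of $A_j,B_j,C_j$ are cyclic modulo $3$ (so $A_4=A_1$, $A_5=A_2$, etc.). This inequality is violated if $\varphi_2$ is the rank function of the non-Desargues matroid, $A_i=\{a_i\}$, $B_i=\{b_i\}$, $C_i=\{c_i\}$ for $i\in\{1,2,3\}$, and $D=\{d\}$.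
   Context: Ground sets are finite. A polymatroid function is a set function $\varphi\colon 2^S\to\mathbb{R}$ that is increasing, submodular, and satisfies $\varphi(\emptyset)=0$. A tensor product of polymatroid functions $\varphi_1\colon 2^{S_1}\to\mathbb{R}$ and $\varphi_2\colon 2^{S_2}\to\mathbb{R}$ is a polymatroid function $\varphi\colon 2^{S_1\times S_2}\to\mathbb{R}$ with $\varphi(X_1\times X_2)=\varphi_1(X_1)\varphi_2(X_2)$ for all $X_1\subseteq S_1$, $X_2\subseteq S_2$. The non-Desargues matroid is the simple rank-$3$ matroid on $\{d,a_1,a_2,a_3,b_1,b_2,b_3,c_1,c_2,c_3\}$ whose lines (rank-$2$ flats) with at least three elements are $\{d,a_1,b_1\}$, $\{d,a_2,b_2\}$, $\{d,a_3,b_3\}$, $\{a_1,a_2,c_3\}$, $\{a_1,a_3,c_2\}$, $\{a_2,a_3,c_1\}$, $\{b_1,b_2,c_3\}$, $\{b_1,b_3,c_2\}$, $\{b_2,b_3,c_1\}$. *)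

theory Defs
  imports "HOL-Analysis.Analysis"
begin

section \<open>Polymatroid functions and tensor products\<close>

text \<open>Set functions are total functions on \<open>'a set\<close>; only their values on subsets of the
  ground set matter.\<close>

definition polymatroid_on :: "'a set \<Rightarrow> ('a set \<Rightarrow> real) \<Rightarrow> bool" where
  "polymatroid_on S \<phi> \<longleftrightarrow>
     finite S \<and>
     (\<forall>X Y. X \<subseteq> Y \<and> Y \<subseteq> S \<longrightarrow> \<phi> X \<le> \<phi> Y) \<and>
     (\<forall>X Y. X \<subseteq> S \<and> Y \<subseteq> S \<longrightarrow> \<phi> (X \<union> Y) + \<phi> (X \<inter> Y) \<le> \<phi> X + \<phi> Y) \<and>
     \<phi> {} = 0"

definition is_tensor_product ::
  "'a set \<Rightarrow> ('a set \<Rightarrow> real) \<Rightarrow> 'b set \<Rightarrow> ('b set \<Rightarrow> real) \<Rightarrow> (('a \<times> 'b) set \<Rightarrow> real) \<Rightarrow> bool" where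
  "is_tensor_product S\<^sub>1 \<phi>\<^sub>1 S\<^sub>2 \<phi>\<^sub>2 \<phi> \<longleftrightarrow>
     polymatroid_on (S\<^sub>1 \<times> S\<^sub>2) \<phi> \<and>
     (\<forall>X\<^sub>1 X\<^sub>2. X\<^sub>1 \<subseteq> S\<^sub>1 \<and> X\<^sub>2 \<subseteq> S\<^sub>2 \<longrightarrow> \<phi> (X\<^sub>1 \<times> X\<^sub>2) = \<phi>\<^sub>1 X\<^sub>1 * \<phi>\<^sub>2 X\<^sub>2)"


section \<open>Matroids, given by their ground set and their independent sets\<close>

definition matroid :: "'a set \<Rightarrow> 'a set set \<Rightarrow> bool" where
  "matroid E \<I> \<longleftrightarrow>
     finite E \<and> \<I> \<subseteq> Pow E \<and> {} \<in> \<I> \<and>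
     (\<forall>X Y. X \<subseteq> Y \<and> Y \<in> \<I> \<longrightarrow> X \<in> \<I>) \<and>
     (\<forall>X\<in>\<I>. \<forall>Y\<in>\<I>. card X < card Y \<longrightarrow> (\<exists>y\<in>Y - X. insert y X \<in> \<I>))"

definition matroid_rank :: "'a set set \<Rightarrow> 'a set \<Rightarrow> nat" where
  "matroid_rank \<I> X = Max (card ` {J \<in> \<I>. J \<subseteq> X})"

definition matroid_flat :: "'a set \<Rightarrow> 'a set set \<Rightarrow> 'a set \<Rightarrow> bool" where
  "matroid_flat E \<I> F \<longleftrightarrow>
     F \<subseteq> E \<and> (\<forall>e\<in>E - F. matroid_rank \<I> F < matroid_rank \<I> (insert e F))"

text \<open>No loops (the case \<open>e = f\<close>) and no pairs of parallel elements.\<close>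

definition matroid_simple :: "'a set \<Rightarrow> 'a set set \<Rightarrow> bool" where
  "matroid_simple E \<I> \<longleftrightarrow> (\<forall>e\<in>E. \<forall>f\<in>E. {e, f} \<in> \<I>)"


section \<open>Graphic matroids\<close>

text \<open>Simple graphs are given by their edge sets, whose members are two-element sets of vertices.\<close>

definition complete_graph_edges :: "'v set \<Rightarrow> 'v set set" where
  "complete_graph_edges V = {e. e \<subseteq> V \<and> card e = 2}"

definition is_cycle :: "'v set set \<Rightarrow> 'v list \<Rightarrow> bool" where
  "is_cycle F vs \<longleftrightarrow>
     3 \<le> length vs \<and> distinct vs \<and>
     (\<forall>i<length vs. {vs ! i, vs ! ((i + 1) mod length vs)} \<in> F)"

definition graphic_matroid :: "'v set set \<Rightarrow> 'v set set set" where
  "graphic_matroid E = {F. F \<subseteq> E \<and> (\<nexists>vs. is_cycle F vs)}"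


section \<open>The non-Desargues matroid\<close>

text \<open>The index type \<open>3\<close> is the ring of integers modulo 3, so that \<open>i + 1\<close> and \<open>i + 2\<close> are
  cyclic shifts; its elements are \<open>1\<close>, \<open>2\<close> and \<open>3 = 0\<close>.\<close>

datatype nd_point = Pt_d | Pt_a 3 | Pt_b 3 | Pt_c 3

definition nd_lines :: "nd_point set set" where
  "nd_lines =
    {{Pt_d, Pt_a 1, Pt_b 1}, {Pt_d, Pt_a 2, Pt_b 2}, {Pt_d, Pt_a 3, Pt_b 3},
     {Pt_a 1, Pt_a 2, Pt_c 3}, {Pt_a 1, Pt_a 3, Pt_c 2}, {Pt_a 2, Pt_a 3, Pt_c 1},
     {Pt_b 1, Pt_b 2, Pt_c 3}, {Pt_b 1, Pt_b 3, Pt_c 2}, {Pt_b 2, Pt_b 3, Pt_c 1}}"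

definition non_Desargues_matroid :: "nd_point set set \<Rightarrow> bool" where
  "non_Desargues_matroid \<I> \<longleftrightarrow>
     matroid UNIV \<I> \<and> matroid_simple UNIV \<I> \<and> matroid_rank \<I> UNIV = 3 \<and>
     {L. matroid_flat UNIV \<I> L \<and> matroid_rank \<I> L = 2 \<and> 3 \<le> card L} = nd_lines"

text \<open>These conditions are satisfiable; the independent sets are the sets of at most three points
  that are not lines.\<close>

lemma finite_nd_points: "finite (UNIV :: nd_point set)"
proof (rule finite_subset)
  show "(UNIV :: nd_point set) \<subseteq> {Pt_d} \<union> range Pt_a \<union> range Pt_b \<union> range Pt_c"
  proof
    show "x \<in> {Pt_d} \<union> range Pt_a \<union> range Pt_b \<union> range Pt_c" for x
      by (cases x) simp_all
  qed
qed simp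

lemma nd_lines_card: "L \<in> nd_lines \<Longrightarrow> card L = 3"
  unfolding nd_lines_def by auto

lemma nd_lines_meet:
  assumes "L \<in> nd_lines" "L' \<in> nd_lines" "x \<in> L" "y \<in> L" "x \<in> L'" "y \<in> L'" "x \<noteq> y"
  shows "L = L'"
proof -
  have "\<forall>L\<in>nd_lines. \<forall>L'\<in>nd_lines. \<forall>x\<in>L. \<forall>y\<in>L. x \<in> L' \<longrightarrow> y \<in> L' \<longrightarrow> x \<noteq> y \<longrightarrow> L = L'"
    unfolding nd_lines_def by (simp add: insert_commute)
  then show ?thesis using assms by blast
qed

lemma non_Desargues_matroid_exists: "\<exists>\<I>. non_Desargues_matroid \<I>"
proof -
  define \<I> where "\<I> = {X :: nd_point set. card X \<le> 3 \<and> X \<notin> nd_lines}"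
  have fin: "finite X" for X :: "nd_point set"
    by (rule finite_subset[OF subset_UNIV finite_nd_points])
  have small: "X \<in> \<I>" if "card X \<le> 2" for X
    using that nd_lines_card[of X] by (auto simp: \<I>_def)
  have line_eq: "X = L" if "X \<subseteq> L" "card X = 3" "L \<in> nd_lines" for X L
    using card_subset_eq[OF fin that(1)] that(2) nd_lines_card[OF that(3)] by simp
  have mat: "matroid UNIV \<I>"
    unfolding matroid_def
  proof (intro conjI ballI allI impI)
    show "finite (UNIV :: nd_point set)" by (rule finite_nd_points)
    show "{} \<in> \<I>" by (rule small) simp
  next
    fix X Y assume *: "X \<subseteq> Y \<and> Y \<in> \<I>"
    then have le: "card X \<le> card Y" by (simp add: card_mono fin)
    show "X \<in> \<I>"
    proof (cases "card X \<le> 2")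
      case False
      then have "card X = card Y" using le * by (auto simp: \<I>_def)
      then have "X = Y" using * card_subset_eq[OF fin, of X Y] by simp
      then show ?thesis using * by simp
    qed (rule small)
  next
    fix X Y assume X: "X \<in> \<I>" and Y: "Y \<in> \<I>" and lt: "card X < card Y"
    have "card Y \<le> 3" using Y by (simp add: \<I>_def)
    have "\<not> Y \<subseteq> X" using lt card_mono[OF fin, of Y X] by linarith
    then obtain y where y: "y \<in> Y - X" by blast
    show "\<exists>y\<in>Y - X. insert y X \<in> \<I>"
    proof (cases "card X \<le> 1")
      case True
      then have "card (insert y X) \<le> 2" using fin y by simp
      then show ?thesis using small y by blast
    next
      case False
      then have c: "card X = 2" "card Y = 3" using lt \<open>card Y \<le> 3\<close> by auto
      then obtain u v where uv: "X = {u, v}" "u \<noteq> v" by (meson card_2_iff)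
      show ?thesis
      proof (rule ccontr)
        assume "\<not> ?thesis"
        then have l: "insert z X \<in> nd_lines" if "z \<in> Y - X" for z
          using that c fin by (auto simp: \<I>_def)
        then have "insert z X = insert y X" if "z \<in> Y - X" for z
          using nd_lines_meet[of "insert z X" "insert y X" u v] that y uv by blast
        then have "Y \<subseteq> insert y X" by blast
        then have "Y = insert y X" using line_eq l y c by metis
        then show False using l[OF y] Y by (simp add: \<I>_def)
      qed
    qed
  qed (simp add: \<I>_def)
  have fc: "finite (card ` {J \<in> \<I>. J \<subseteq> X})" for X
    using fin[of X] by simp
  have ne: "card ` {J \<in> \<I>. J \<subseteq> X} \<noteq> {}" for X
    using small[of "{}"] by auto
  have ge: "card J \<le> matroid_rank \<I> X" if "J \<in> \<I>" "J \<subseteq> X" for J X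
    unfolding matroid_rank_def using that fc by (intro Max_ge) auto
  have le: "matroid_rank \<I> X \<le> k" if "\<And>J. J \<in> \<I> \<Longrightarrow> J \<subseteq> X \<Longrightarrow> card J \<le> k" for X k
    unfolding matroid_rank_def using that fc ne by (subst Max_le_iff) auto
  have rank3: "matroid_rank \<I> UNIV = 3"
  proof (rule antisym)
    show "matroid_rank \<I> UNIV \<le> 3" by (rule le) (simp add: \<I>_def)
    have "{Pt_c 1, Pt_c 2, Pt_c 3} \<in> \<I>"
    proof -
      have "\<not> L \<subseteq> range Pt_c" if "L \<in> nd_lines" for L
        using that unfolding nd_lines_def by auto
      then have "{Pt_c 1, Pt_c 2, Pt_c 3} \<notin> nd_lines" by blast
      then show ?thesis by (simp add: \<I>_def)
    qed
    from ge[OF this subset_UNIV] show "3 \<le> matroid_rank \<I> UNIV" by simp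
  qed
  have line: "matroid_flat UNIV \<I> L \<and> matroid_rank \<I> L = 2 \<and> 3 \<le> card L" if L: "L \<in> nd_lines" for L
  proof -
    have c: "card L = 3" using L by (rule nd_lines_card)
    then obtain u v w where uvw: "L = {u, v, w}" "u \<noteq> v" "u \<noteq> w" "v \<noteq> w"
      by (metis card_3_iff)
    have "card J \<le> 2" if "J \<in> \<I>" "J \<subseteq> L" for J
    proof -
      have "J \<noteq> L" using that L by (auto simp: \<I>_def)
      then have "card J < card L" using that fin by (meson psubsetI psubset_card_mono)
      then show ?thesis using c by simp
    qed
    then have "matroid_rank \<I> L \<le> 2" by (rule le)
    moreover have "2 \<le> matroid_rank \<I> L" using ge[of "{u, v}" L] small[of "{u, v}"] uvw by auto
    ultimately have r: "matroid_rank \<I> L = 2" by simp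
    have "2 < matroid_rank \<I> (insert e L)" if e: "e \<notin> L" for e
    proof -
      have "{u, v, e} \<notin> nd_lines"
        using nd_lines_meet[OF L, of "{u, v, e}" u v] uvw e by auto
      moreover have "card {u, v, e} = 3" using uvw e by auto
      ultimately have "{u, v, e} \<in> \<I>" by (simp add: \<I>_def)
      then have "card {u, v, e} \<le> matroid_rank \<I> (insert e L)" by (rule ge) (use uvw in auto)
      then show ?thesis using \<open>card {u, v, e} = 3\<close> by simp
    qed
    then show ?thesis using r c by (simp add: matroid_flat_def)
  qed
  have flat: "L \<in> nd_lines" if r: "matroid_rank \<I> L = 2" and c: "3 \<le> card L" for L
  proof -
    have *: "T \<in> nd_lines" if "T \<subseteq> L" "card T = 3" for T
      using ge[of T L] that r by (auto simp: \<I>_def)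
    obtain T where T: "T \<subseteq> L" "card T = 3" using c by (meson obtain_subset_with_card_n)
    then obtain u v w where uvw: "T = {u, v, w}" "u \<noteq> v" "u \<noteq> w" "v \<noteq> w"
      by (metis card_3_iff)
    have "x \<in> T" if x: "x \<in> L" for x
    proof (rule ccontr)
      assume nx: "x \<notin> T"
      then have "{u, v, x} \<in> nd_lines" using uvw T x by (intro *) auto
      then have "{u, v, x} = T" using nd_lines_meet[of "{u, v, x}" T u v] *[OF T] uvw by auto
      then show False using nx by auto
    qed
    then have "L = T" using T by blast
    then show ?thesis using *[OF T] by simp
  qed
  have "matroid_simple UNIV \<I>"
    unfolding matroid_simple_def using small by (simp add: card_insert_if)
  then have "non_Desargues_matroid \<I>"
    unfolding non_Desargues_matroid_def using mat rank3 line flat by blast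
  then show ?thesis by blast
qed


section \<open>The inequality\<close>

definition desargues_ineq ::
  "('a set \<Rightarrow> real) \<Rightarrow> (3 \<Rightarrow> 'a set) \<Rightarrow> (3 \<Rightarrow> 'a set) \<Rightarrow> (3 \<Rightarrow> 'a set) \<Rightarrow> 'a set \<Rightarrow> bool" where
  "desargues_ineq \<phi> A B C D \<longleftrightarrow>
     (\<Sum>i\<in>UNIV. 2 * \<phi> (A (i+1) \<union> A (i+2) \<union> B (i+1) \<union> B (i+2) \<union> C i)
                 + \<phi> (A i \<union> D) + \<phi> (B i \<union> D) + \<phi> (C i))
       + \<phi> (C 2) + \<phi> (A 3 \<union> B 3 \<union> C 1) + \<phi> (A 1 \<union> A 2 \<union> B 1 \<union> B 2) + \<phi> (C 1 \<union> C 2 \<union> C 3)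
     \<le> 2 * (\<Sum>i\<in>UNIV. \<phi> (A (i+1) \<union> A (i+2) \<union> C i) + \<phi> (B (i+1) \<union> B (i+2) \<union> C i)
                      + \<phi> (A i \<union> B i \<union> D))
       + \<phi> (C 1 \<union> C 2) + 4 * \<phi> D"

end

theory Submission
  imports Defs
begin

text \<open>
  Let \<open>t\<close> be a tensor product of the rank function of \<open>M(K\<^sub>4)\<close> with \<open>\<phi>\<close>. View \<open>K\<^sub>4\<close> as a wheel
  with spokes \<open>s i\<close> from the hub to the rim vertices \<open>1, 2, 3\<close>, and let \<open>q i\<close> be the rim edge that
  misses the vertex \<open>i\<close>. For a family \<open>X\<close> of three subsets of the ground set of \<open>\<phi>\<close>, write \<open>star X\<close>
  for the union of the sets \<open>{s i} \<times> X i\<close> and \<open>rim X\<close> for the union of the sets \<open>{q i} \<times> X i\<close>.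

  The proof has its origin in the linear case. Suppose that \<open>a\<^sub>i\<close>, \<open>b\<^sub>i\<close>, \<open>c\<^sub>i\<close>, \<open>d\<close> are vectors in
  otherwise general position with \<open>a\<^sub>1, a\<^sub>2, a\<^sub>3\<close> and \<open>b\<^sub>1, b\<^sub>2, b\<^sub>3\<close> independent, \<open>c\<^sub>i\<close> is on the lines \<open>a\<^sub>j a\<^sub>k\<close> and \<open>b\<^sub>j b\<^sub>k\<close>, and \<open>d\<close> is
  on the lines \<open>a\<^sub>i b\<^sub>i\<close>. The six tensors \<open>s i \<otimes> c\<^sub>i\<close>, \<open>q i \<otimes> a\<^sub>i\<close> lie in the span of the six tensors
  \<open>s i \<otimes> a\<^sub>j\<close> with \<open>i \<noteq> j\<close>; they are combinations of two of these each, arranged in a hexagon, and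
  they are dependent exactly when \<open>c\<^sub>1, c\<^sub>2, c\<^sub>3\<close> are collinear. If they are independent, then they
  span all tensors \<open>s i \<otimes> a\<^sub>j\<close> with \<open>i \<noteq> j\<close>. The same is true for the \<open>b\<^sub>i\<close>. So the tensors \<open>s i \<otimes> c\<^sub>i\<close>,
  \<open>q i \<otimes> a\<^sub>i\<close>, \<open>q i \<otimes> b\<^sub>i\<close> then span, for each \<open>i\<close>, the space \<open>s i \<otimes> \<langle>a\<^sub>j, a\<^sub>k, b\<^sub>j, b\<^sub>k\<rangle>\<close>, which for a
  planar configuration is everything, of dimension \<open>9\<close>. But the three tensors \<open>q i \<otimes> d\<close> span only
  two dimensions, and modulo them \<open>q i \<otimes> a\<^sub>i\<close> and \<open>q i \<otimes> b\<^sub>i\<close> agree, so the dimension is at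
  most \<open>3 + 3 + 2 = 8\<close>. This contradiction is Desargues' theorem.

  The inequality records this count for sets. Put \<open>P X = star C \<union> rim X\<close>, and let \<open>R X\<close> be \<open>P X\<close>
  together with \<open>{s i} \<times> (X (i+1) \<union> X (i+2) \<union> C i)\<close> for all \<open>i\<close>. Let \<open>G i = A i \<union> B i\<close>, and let
  \<open>Q X\<close> be \<open>P X\<close> together with all \<open>(q i, x)\<close>, \<open>x \<in> D\<close>. Sums run over \<open>i\<close>. Then

  \<^item> \<open>\<Sum> \<phi> (A (i+1) \<union> A (i+2) \<union> B (i+1) \<union> B (i+2) \<union> C i) \<le> t (Q G) + (t (R A) - t (P A)) + (t (R B) - t (P B))\<close>,
    because the three spokes are independent and \<open>Q G \<union> R A \<union> R B\<close> contains the star of these sets;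
  \<^item> \<open>t (R X) \<le> \<Sum> \<phi> (X (i+1) \<union> X (i+2) \<union> C i)\<close>, as the spokes at the ends of \<open>q i\<close> span \<open>q i\<close>
    (lemma \<open>star_spans_rim\<close>);
  \<^item> \<open>t (Q G) \<le> t (Q X) + \<Sum> (\<phi> (A i \<union> B i \<union> D) - \<phi> (X i \<union> D))\<close> for \<open>X = A\<close> and \<open>X = B\<close>, and
    \<open>t (Q X) \<le> t (P X) + 2 * \<phi> D\<close>, as the rim has rank two;
  \<^item> \<open>t (P A) + t (P B) \<ge> t (P G) + t (star C)\<close> by submodularity;
  \<^item> \<open>t (P G)\<close> is bounded from below by the lemma \<open>wheel_lower_bound\<close>, which is where the rank of
    \<open>C 1 \<union> C 2 \<union> C 3\<close> comes in.

  Twice the first line, with the others inserted, is the claim.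

  For the non-Desargues matroid every three points on no common line form a basis, so all ranks in
  the inequality are known; the two sides are \<open>43\<close> and \<open>42\<close>.
\<close>

section \<open>Bounding a tensor product from its values on products\<close>

locale tensor_product =
  fixes S\<^sub>1 :: "'e set" and r :: "'e set \<Rightarrow> real" and S\<^sub>2 :: "'a set" and \<phi> :: "'a set \<Rightarrow> real"
    and t :: "('e \<times> 'a) set \<Rightarrow> real"
  assumes tensor: "is_tensor_product S\<^sub>1 r S\<^sub>2 \<phi> t"
begin

lemma mono: "X \<subseteq> Y \<Longrightarrow> Y \<subseteq> S\<^sub>1 \<times> S\<^sub>2 \<Longrightarrow> t X \<le> t Y"
  using tensor by (simp add: is_tensor_product_def polymatroid_on_def)

lemma submodular:
  "X \<subseteq> S\<^sub>1 \<times> S\<^sub>2 \<Longrightarrow> Y \<subseteq> S\<^sub>1 \<times> S\<^sub>2 \<Longrightarrow> t (X \<union> Y) + t (X \<inter> Y) \<le> t X + t Y"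
  using tensor by (simp add: is_tensor_product_def polymatroid_on_def)

lemma product: "X \<subseteq> S\<^sub>1 \<Longrightarrow> Y \<subseteq> S\<^sub>2 \<Longrightarrow> t (X \<times> Y) = r X * \<phi> Y"
  using tensor by (simp add: is_tensor_product_def)

lemma empty: "t {} = 0"
  using tensor by (simp add: is_tensor_product_def polymatroid_on_def)

text \<open>The only way in which submodularity is used: adding \<open>Y\<close> costs no more on top of \<open>X\<close> than it does
  on top of a smaller set \<open>Z\<close>. The set \<open>Z\<close> is left free because \<open>X \<inter> Y\<close> is in general not a product
  and has no known value.\<close>

lemma attach:
  assumes "X \<subseteq> S\<^sub>1 \<times> S\<^sub>2" "Y \<subseteq> S\<^sub>1 \<times> S\<^sub>2" "Z \<subseteq> X" "Z \<subseteq> Y"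
  shows "t (X \<union> Y) \<le> t X + (t Y - t Z)"
proof -
  have "t Z \<le> t (X \<inter> Y)" using assms by (intro mono) auto
  then show ?thesis using submodular[of X Y] assms by simp
qed

lemma attach_family:
  assumes "finite I" "X \<subseteq> S\<^sub>1 \<times> S\<^sub>2"
    and "\<And>i. i \<in> I \<Longrightarrow> Y i \<subseteq> S\<^sub>1 \<times> S\<^sub>2 \<and> Z i \<subseteq> X \<and> Z i \<subseteq> Y i"
  shows "t (X \<union> (\<Union>i\<in>I. Y i)) \<le> t X + (\<Sum>i\<in>I. t (Y i) - t (Z i))"
  using assms(1,3)
proof (induction I rule: finite_induct)
  case (insert j J)
  have "t ((X \<union> (\<Union>i\<in>J. Y i)) \<union> Y j) \<le> t (X \<union> (\<Union>i\<in>J. Y i)) + (t (Y j) - t (Z j))"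
    using insert.prems assms(2) by (intro attach) blast+
  moreover have "X \<union> (\<Union>i\<in>insert j J. Y i) = (X \<union> (\<Union>i\<in>J. Y i)) \<union> Y j" by blast
  ultimately show ?case using insert by simp
qed simp

text \<open>After contraction of \<open>L\<close>, the elements of \<open>H\<close> are parallel to each other, so the sets attached to
  them act like a single copy of their union: each \<open>h \<in> H\<close> together with \<open>L\<close> spans all of \<open>H\<close>.\<close>

lemma contraction:
  assumes sub: "L \<subseteq> S\<^sub>1" "H \<subseteq> S\<^sub>1" "\<And>h. h \<in> H \<Longrightarrow> X h \<subseteq> S\<^sub>2" and fin: "finite H"
    and point: "\<And>h. h \<in> H \<Longrightarrow> r {h} = 1"
    and above: "\<And>h. h \<in> H \<Longrightarrow> r (insert h L) = r L + 1"
    and parallel: "r (H \<union> L) = r L + 1"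
  shows "t (L \<times> S\<^sub>2 \<union> (\<Union>h\<in>H. {h} \<times> X h)) = r L * \<phi> S\<^sub>2 + \<phi> (\<Union>h\<in>H. X h)"
proof (rule antisym)
  define U where "U = (\<Union>h\<in>H. X h)"
  have U: "U \<subseteq> S\<^sub>2" using sub by (auto simp: U_def)
  have "t (L \<times> S\<^sub>2 \<union> (\<Union>h\<in>H. {h} \<times> X h)) \<le> t (L \<times> S\<^sub>2 \<union> (H \<union> L) \<times> U)"
    using sub U by (intro mono) (auto simp: U_def)
  also have "\<dots> \<le> t (L \<times> S\<^sub>2) + (t ((H \<union> L) \<times> U) - t (L \<times> U))"
    using sub U by (intro attach) auto
  also have "\<dots> = r L * \<phi> S\<^sub>2 + \<phi> U"
    using sub U parallel by (simp add: product algebra_simps)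
  finally show "t (L \<times> S\<^sub>2 \<union> (\<Union>h\<in>H. {h} \<times> X h)) \<le> r L * \<phi> S\<^sub>2 + \<phi> (\<Union>h\<in>H. X h)"
    by (simp add: U_def)

  \<comment> \<open>\<open>?W'\<close> spreads each \<open>X h\<close> over all of \<open>H\<close>, which does not raise \<open>t\<close>. It thus contains
    the whole union over one fixed \<open>h\<close>, and filling this up to \<open>S\<^sub>2\<close> gives a lower bound.\<close>
  let ?W = "L \<times> S\<^sub>2 \<union> (\<Union>h\<in>H. {h} \<times> X h)"
  let ?W' = "?W \<union> (\<Union>h\<in>H. (H \<union> L) \<times> X h)"
  obtain h where h: "h \<in> H" using parallel by fastforce
  have W: "?W \<subseteq> S\<^sub>1 \<times> S\<^sub>2" using sub by blast
  have W': "?W' \<subseteq> S\<^sub>1 \<times> S\<^sub>2" using sub by blast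
  have "t ?W' \<le> t ?W + (\<Sum>h\<in>H. t ((H \<union> L) \<times> X h) - t (insert h L \<times> X h))"
    using sub fin W by (intro attach_family) (auto dest: subsetD)
  also have "(\<Sum>h\<in>H. t ((H \<union> L) \<times> X h) - t (insert h L \<times> X h)) = 0"
    using sub by (intro sum.neutral) (auto simp: product above parallel)
  finally have le: "t ?W' \<le> t ?W" by simp
  have "r (insert h L) * \<phi> S\<^sub>2 = t (insert h L \<times> S\<^sub>2)"
    using sub h by (subst product) auto
  also have "\<dots> \<le> t (?W' \<union> {h} \<times> S\<^sub>2)"
    using sub h W' by (intro mono) auto
  also have "\<dots> \<le> t ?W' + (t ({h} \<times> S\<^sub>2) - t ({h} \<times> U))"
    using sub h W' U by (intro attach) (auto simp: U_def)
  also have "\<dots> = t ?W' + (\<phi> S\<^sub>2 - \<phi> U)"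
    using U product[of "{h}"] sub(2) h by (simp add: subset_iff point)
  finally have "(r L + 1) * \<phi> S\<^sub>2 \<le> t ?W' + (\<phi> S\<^sub>2 - \<phi> U)"
    using above[OF h] by simp
  then show "r L * \<phi> S\<^sub>2 + \<phi> (\<Union>h\<in>H. X h) \<le> t ?W"
    using le by (simp add: U_def algebra_simps)
qed

text \<open>Enlarging \<open>Z\<close> to \<open>L \<times> S\<^sub>2\<close> can only decrease what the part over \<open>H\<close> contributes, and over
  \<open>L \<times> S\<^sub>2\<close> its contribution is known.\<close>

lemma contraction_marginal:
  assumes sub: "L \<subseteq> S\<^sub>1" "H \<subseteq> S\<^sub>1" "\<And>h. h \<in> H \<Longrightarrow> X h \<subseteq> S\<^sub>2" and fin: "finite H"
    and point: "\<And>h. h \<in> H \<Longrightarrow> r {h} = 1"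
    and above: "\<And>h. h \<in> H \<Longrightarrow> r (insert h L) = r L + 1"
    and parallel: "r (H \<union> L) = r L + 1"
    and Z: "Z \<subseteq> L \<times> S\<^sub>2"
  shows "t Z + \<phi> (\<Union>h\<in>H. X h) \<le> t (Z \<union> (\<Union>h\<in>H. {h} \<times> X h))"
proof -
  let ?H = "\<Union>h\<in>H. {h} \<times> X h"
  have "t (L \<times> S\<^sub>2 \<union> ?H) = r L * \<phi> S\<^sub>2 + \<phi> (\<Union>h\<in>H. X h)"
    using assms by (intro contraction) auto
  moreover have "L \<times> S\<^sub>2 \<union> ?H = (Z \<union> ?H) \<union> L \<times> S\<^sub>2" using Z by blast
  moreover have "t ((Z \<union> ?H) \<union> L \<times> S\<^sub>2) \<le> t (Z \<union> ?H) + (t (L \<times> S\<^sub>2) - t Z)"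
    using Z sub by (intro attach) blast+
  ultimately show ?thesis using sub by (simp add: product)
qed

end

lemma mod_3_numerals: "(4::3) = 1" "(5::3) = 2" "i + 3 = (i::3)" "i + 4 = (i::3) + 1"
proof -
  show four: "(4::3) = 1" and "(5::3) = 2" and "i + 3 = i" by simp_all
  show "i + 4 = i + 1" by (simp add: four)
qed

section \<open>The inequality for the wheel with three spokes\<close>

text \<open>The locale keeps just those ranks of \<open>M(K\<^sub>4)\<close> that the inequality depends on. In the last
  assumption, the path formed by two rim edges, together with any spoke, is a spanning tree.\<close>

locale k4_tensor = tensor_product S\<^sub>1 r S\<^sub>2 \<phi> t
  for S\<^sub>1 :: "'e set" and r :: "'e set \<Rightarrow> real" and S\<^sub>2 :: "'a set" and \<phi> :: "'a set \<Rightarrow> real"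
    and t :: "('e \<times> 'a) set \<Rightarrow> real" +
  fixes s q :: "3 \<Rightarrow> 'e"
  assumes edges: "S\<^sub>1 = range s \<union> range q"
    and rank_edge: "g \<in> S\<^sub>1 \<Longrightarrow> r {g} = 1"
    and rank_two_edges: "g \<in> S\<^sub>1 \<Longrightarrow> h \<in> S\<^sub>1 \<Longrightarrow> g \<noteq> h \<Longrightarrow> r {g, h} = 2"
    and distinct_edges: "inj s" "inj q" "s i \<noteq> q j"
    and rank_rim: "r (range q) = 2"
    and rank_triangle: "r {s (i+1), s (i+2), q i} = 2"
    and rank_star: "r (range s) = 3"
    and rank_full: "j \<noteq> k \<Longrightarrow> {s i, q j, q k} \<subseteq> X \<Longrightarrow> X \<subseteq> S\<^sub>1 \<Longrightarrow> r X = 3"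
begin

lemma edge [simp]: "s i \<in> S\<^sub>1" "q i \<in> S\<^sub>1"
  by (auto simp: edges)

lemma s_eq [simp]: "s i = s j \<longleftrightarrow> i = j" and q_eq [simp]: "q i = q j \<longleftrightarrow> i = j"
  using distinct_edges by (auto dest: injD)

lemma finite_edges: "finite S\<^sub>1"
  by (simp add: edges)

text \<open>The spokes form a basis, so the parts over them are in direct sum: filling up each part to
  \<open>{s i} \<times> S\<^sub>2\<close> costs \<open>\<phi> S\<^sub>2 - \<phi> (X i)\<close> at most, and must reach \<open>3 * \<phi> S\<^sub>2\<close>.\<close>

lemma star_sum:
  assumes X: "\<And>i. X i \<subseteq> S\<^sub>2"
  shows "t (\<Union>i. {s i} \<times> X i) = (\<Sum>i\<in>UNIV. \<phi> (X i))"
proof (rule antisym)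
  have pr: "t ({s i} \<times> X i) = \<phi> (X i)" "t ({s i} \<times> S\<^sub>2) = \<phi> S\<^sub>2" for i
    using X[of i] by (simp_all add: product rank_edge)
  have "t ({} \<union> (\<Union>i. {s i} \<times> X i)) \<le> t {} + (\<Sum>i\<in>UNIV. t ({s i} \<times> X i) - t {})"
    using X by (intro attach_family) auto
  then show "t (\<Union>i. {s i} \<times> X i) \<le> (\<Sum>i\<in>UNIV. \<phi> (X i))"
    by (simp add: empty pr)
  let ?X = "\<Union>i. {s i} \<times> X i"
  have sub: "?X \<subseteq> S\<^sub>1 \<times> S\<^sub>2" using X by auto
  have "3 * \<phi> S\<^sub>2 = t (range s \<times> S\<^sub>2)"
    by (subst product) (auto simp: rank_star)
  also have "range s \<times> S\<^sub>2 = ?X \<union> (\<Union>i. {s i} \<times> S\<^sub>2)" using X by blast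
  also have "t \<dots> \<le> t ?X + (\<Sum>i\<in>UNIV. t ({s i} \<times> S\<^sub>2) - t ({s i} \<times> X i))"
    using X sub by (intro attach_family) auto
  finally show "(\<Sum>i\<in>UNIV. \<phi> (X i)) \<le> t ?X"
    by (simp add: pr sum_subtractf)
qed

text \<open>Each point of \<open>A i\<close> occurs over both spokes that form a triangle with \<open>q i\<close>, so the part over the
  rim edge is free of cost.\<close>

lemma star_spans_rim:
  assumes X: "\<And>i. X i \<subseteq> S\<^sub>2" and A: "\<And>i. A (i+1) \<union> A (i+2) \<subseteq> X i"
  shows "t ((\<Union>i. {s i} \<times> X i) \<union> (\<Union>i. {q i} \<times> A i)) \<le> (\<Sum>i\<in>UNIV. \<phi> (X i))"
proof -
  let ?X = "\<Union>i. {s i} \<times> X i"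
  have sub: "?X \<subseteq> S\<^sub>1 \<times> S\<^sub>2" using X by auto
  have A': "A i \<subseteq> X (i+1)" "A i \<subseteq> X (i+2)" "A i \<subseteq> S\<^sub>2" for i
    using A[of "i+1"] A[of "i+2"] X[of "i+1"] by (auto simp: add.assoc mod_3_numerals)
  have "t (?X \<union> (\<Union>i. {q i} \<times> A i)) \<le> t (?X \<union> (\<Union>i. {s (i+1), s (i+2), q i} \<times> A i))"
    using sub by (intro mono) (auto intro: subsetD[OF A'(3)])
  also have "\<dots> \<le> t ?X + (\<Sum>i\<in>UNIV. t ({s (i+1), s (i+2), q i} \<times> A i) - t ({s (i+1), s (i+2)} \<times> A i))"
  proof (intro attach_family conjI sub)
    fix i
    show "{s (i+1), s (i+2)} \<times> A i \<subseteq> ?X" using A'[of i] by auto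
  qed (auto intro: subsetD[OF A'(3)])
  also have "(\<Sum>i\<in>UNIV. t ({s (i+1), s (i+2), q i} \<times> A i) - t ({s (i+1), s (i+2)} \<times> A i)) = 0"
    using A' by (intro sum.neutral) (simp add: product rank_triangle rank_two_edges)
  finally show ?thesis using X by (simp add: star_sum)
qed

text \<open>Build the set up in four steps and bound each increment by a contraction in which the new edges
  become parallel: \<open>s 2\<close> alone; then \<open>s 1\<close> and \<open>q 3\<close>, parallel after contracting \<open>s 2\<close>; then \<open>q 1\<close> and
  \<open>q 2\<close>, parallel after contracting the triangle \<open>s 1, s 2, q 3\<close>; finally \<open>s 3\<close>, which is parallel to the
  other two spokes after contracting the rim. Before the last step the set already has parts over
  the spokes \<open>s 1\<close> and \<open>s 2\<close>, outside the contracted rim, so that increment is the difference between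
  two values in the contraction.\<close>

lemma wheel_lower_bound:
  assumes C: "\<And>i. C i \<subseteq> S\<^sub>2" and G: "\<And>i. G i \<subseteq> S\<^sub>2"
  shows "\<phi> (C 2) + \<phi> (G 3 \<union> C 1) + \<phi> (G 1 \<union> G 2) + (\<phi> (C 1 \<union> C 2 \<union> C 3) - \<phi> (C 1 \<union> C 2))
         \<le> t ((\<Union>i. {s i} \<times> C i) \<union> (\<Union>i. {q i} \<times> G i))"
proof -
  define N where "N = {s 2} \<times> C 2"
  define N' where "N' = N \<union> ({s 1} \<times> C 1 \<union> {q 3} \<times> G 3)"
  define N'' where "N'' = N' \<union> ({q 1} \<times> G 1 \<union> {q 2} \<times> G 2)"
  let ?P = "(\<Union>i. {s i} \<times> C i) \<union> (\<Union>i. {q i} \<times> G i)"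
  have "t N = \<phi> (C 2)" using C[of 2] product[of "{s 2}" "C 2"] by (simp add: N_def rank_edge)
  moreover have "t N + \<phi> (G 3 \<union> C 1) \<le> t N'"
  proof -
    have "t N + \<phi> (\<Union>h\<in>{s 1, q 3}. if h = s 1 then C 1 else G 3)
        \<le> t (N \<union> (\<Union>h\<in>{s 1, q 3}. {h} \<times> (if h = s 1 then C 1 else G 3)))"
    proof (rule contraction_marginal[of "{s 2}"])
      have "r {s 1, s 2, q 3} = 2" using rank_triangle[of 3] by (simp add: mod_3_numerals)
      then show "r ({s 1, q 3} \<union> {s 2}) = r {s 2} + 1"
        by (simp add: insert_commute rank_edge)
      fix h assume "h \<in> {s 1, q 3}"
      then show "r (insert h {s 2}) = r {s 2} + 1"
        using rank_two_edges[of "s 1" "s 2"] rank_two_edges[of "q 3" "s 2"] distinct_edges(3)[of 2 3]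
        by (auto simp: rank_edge)
    qed (use C G in \<open>auto simp: N_def rank_edge split: if_splits\<close>)
    then show ?thesis
      using distinct_edges(3)[of 1 3] by (simp add: N'_def Un_commute not_sym)
  qed
  moreover have "t N' + \<phi> (G 1 \<union> G 2) \<le> t N''"
  proof -
    have r: "r {s 1, s 2, q 3} = 2" using rank_triangle[of 3] by (simp add: mod_3_numerals)
    have r': "r X = 3" if "{s 1, q j, q 3} \<subseteq> X" "X \<subseteq> S\<^sub>1" "j = 1 \<or> j = 2" for X j
    proof (rule rank_full[of j 3 1])
      show "j \<noteq> 3" using that(3) by auto
    qed (use that in simp_all)
    have "t N' + \<phi> (\<Union>h\<in>{q 1, q 2}. if h = q 1 then G 1 else G 2)
        \<le> t (N' \<union> (\<Union>h\<in>{q 1, q 2}. {h} \<times> (if h = q 1 then G 1 else G 2)))"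
    proof (rule contraction_marginal[of "{s 1, s 2, q 3}"])
      show "r ({q 1, q 2} \<union> {s 1, s 2, q 3}) = r {s 1, s 2, q 3} + 1"
        by (simp add: r r'[of 1])
      fix h assume "h \<in> {q 1, q 2}"
      then show "r (insert h {s 1, s 2, q 3}) = r {s 1, s 2, q 3} + 1"
        by (auto simp: r r'[of 1] r'[of 2])
    qed (use C G in \<open>auto simp: N_def N'_def rank_edge split: if_splits\<close>)
    then show ?thesis by (simp add: N''_def Un_commute[of "G 1" "G 2"])
  qed
  moreover have "t N'' + (\<phi> (C 1 \<union> C 2 \<union> C 3) - \<phi> (C 1 \<union> C 2)) \<le> t ?P"
  proof -
    have contr: "t (range q \<times> S\<^sub>2 \<union> (\<Union>h\<in>H. {h} \<times> X h)) = 2 * \<phi> S\<^sub>2 + \<phi> (\<Union>h\<in>H. X h)"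
      if "\<And>h. h \<in> H \<Longrightarrow> X h \<subseteq> S\<^sub>2" "H \<subseteq> range s" "H \<noteq> {}" for H X
    proof -
      have r: "r Y = 3" if "s i \<in> Y" "range q \<subseteq> Y" "Y \<subseteq> S\<^sub>1" for Y i
        using that by (intro rank_full[of 1 2 i]) (simp_all add: image_subset_iff)
      obtain i where i: "s i \<in> H" using \<open>H \<noteq> {}\<close> \<open>H \<subseteq> range s\<close> by auto
      have H: "H \<subseteq> S\<^sub>1" using \<open>H \<subseteq> range s\<close> by (auto simp: edges)
      have "r (H \<union> range q) = 3" using i H by (intro r[of i]) auto
      moreover have "r (insert h (range q)) = 3" if "h \<in> H" for h
      proof -
        obtain i where "h = s i" using \<open>h \<in> H\<close> \<open>H \<subseteq> range s\<close> by fast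
        then show ?thesis by (intro r[of i]) auto
      qed
      ultimately show ?thesis
        using that H finite_subset[OF H finite_edges] contraction[of "range q" H X]
        by (auto simp: rank_rim rank_edge subset_iff edges)
    qed
    have "t (N'' \<union> range q \<times> S\<^sub>2) = 2 * \<phi> S\<^sub>2 + \<phi> (C 1 \<union> C 2)"
    proof -
      have "N'' \<union> range q \<times> S\<^sub>2 = range q \<times> S\<^sub>2 \<union> (\<Union>h\<in>s ` {1, 2}. {h} \<times> C (inv s h))"
        using G distinct_edges(1) by (auto simp: N_def N'_def N''_def)
      then show ?thesis using contr[of "s ` {1, 2}" "\<lambda>h. C (inv s h)"] C distinct_edges(1) by auto
    qed
    moreover have "t (?P \<union> range q \<times> S\<^sub>2) = 2 * \<phi> S\<^sub>2 + \<phi> (C 1 \<union> C 2 \<union> C 3)"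
    proof -
      have "?P \<union> range q \<times> S\<^sub>2 = range q \<times> S\<^sub>2 \<union> (\<Union>h\<in>range s. {h} \<times> C (inv s h))"
        using G distinct_edges(1) by auto
      moreover have "(\<Union>h\<in>range s. C (inv s h)) = C 1 \<union> C 2 \<union> C 3"
      proof -
        have "(\<Union>h\<in>range s. C (inv s h)) = (\<Union>i\<in>UNIV. C i)"
          using distinct_edges(1) by simp
        then show ?thesis by (simp only: UNIV_3) auto
      qed
      ultimately show ?thesis using contr[of "range s" "\<lambda>h. C (inv s h)"] C distinct_edges(1) by auto
    qed
    moreover have "t (?P \<union> (N'' \<union> range q \<times> S\<^sub>2)) \<le> t ?P + (t (N'' \<union> range q \<times> S\<^sub>2) - t N'')"
      using C G by (intro attach) (auto simp: N_def N'_def N''_def)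
    moreover have "?P \<union> (N'' \<union> range q \<times> S\<^sub>2) = ?P \<union> range q \<times> S\<^sub>2"
      by (auto simp: N_def N'_def N''_def)
    ultimately show ?thesis by simp
  qed
  ultimately show ?thesis by linarith
qed

lemma desargues:
  assumes A: "\<And>i. A i \<subseteq> S\<^sub>2" and B: "\<And>i. B i \<subseteq> S\<^sub>2" and C: "\<And>i. C i \<subseteq> S\<^sub>2" and D: "D \<subseteq> S\<^sub>2"
  shows "desargues_ineq \<phi> A B C D"
proof -
  define star where "star = (\<lambda>X. \<Union>i. {s i} \<times> (X i :: 'a set))"
  define rim where "rim = (\<lambda>X. \<Union>i. {q i} \<times> (X i :: 'a set))"
  define G where "G = (\<lambda>i. A i \<union> B i)"
  define P where "P = (\<lambda>X. star C \<union> rim X)"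
  define R where "R = (\<lambda>X. star (\<lambda>i. X (i+1) \<union> X (i+2) \<union> C i) \<union> rim X)"
  define Q where "Q = (\<lambda>X. P X \<union> range q \<times> D)"
  note defs = star_def rim_def P_def R_def Q_def G_def
  have G: "G i \<subseteq> S\<^sub>2" for i using A B by (simp add: G_def)
  have ground: "P X \<subseteq> S\<^sub>1 \<times> S\<^sub>2" "R X \<subseteq> S\<^sub>1 \<times> S\<^sub>2" "Q X \<subseteq> S\<^sub>1 \<times> S\<^sub>2" if "\<And>i. X i \<subseteq> S\<^sub>2" for X
    using that C D by (auto simp: defs)
  have R_le: "t (R X) \<le> (\<Sum>i\<in>UNIV. \<phi> (X (i+1) \<union> X (i+2) \<union> C i))" if "\<And>i. X i \<subseteq> S\<^sub>2" for X
    unfolding R_def star_def rim_def using that C by (intro star_spans_rim) auto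
  have QG_le_QX: "t (Q G) \<le> t (Q X) + (\<Sum>i\<in>UNIV. \<phi> (A i \<union> B i \<union> D) - \<phi> (X i \<union> D))"
    if X: "\<And>i. X i \<subseteq> G i" for X
  proof -
    have X2: "X i \<subseteq> S\<^sub>2" for i using X G by blast
    have pr: "t ({q i} \<times> Y) = \<phi> Y" if "Y \<subseteq> S\<^sub>2" for i Y using that by (simp add: product rank_edge)
    have "t (Q G) = t (Q X \<union> (\<Union>i. {q i} \<times> (A i \<union> B i \<union> D)))"
      using X by (intro arg_cong[of _ _ t]) (auto simp: defs)
    also have "\<dots> \<le> t (Q X) + (\<Sum>i\<in>UNIV. t ({q i} \<times> (A i \<union> B i \<union> D)) - t ({q i} \<times> (X i \<union> D)))"
    proof (intro attach_family conjI ground(3)[of X, OF X2])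
      fix i
      show "{q i} \<times> (A i \<union> B i \<union> D) \<subseteq> S\<^sub>1 \<times> S\<^sub>2" using A[of i] B[of i] D by auto
      show "{q i} \<times> (X i \<union> D) \<subseteq> {q i} \<times> (A i \<union> B i \<union> D)" using X[of i] by (auto simp: G_def)
    qed (auto simp: defs)
    finally show ?thesis using A B D X2 by (simp add: pr)
  qed
  have QX_le_PX: "t (Q X) \<le> t (P X) + 2 * \<phi> D" if X: "\<And>i. X i \<subseteq> S\<^sub>2" for X
  proof -
    have "t (Q X) \<le> t (P X) + (t (range q \<times> D) - t {})"
      unfolding Q_def using D by (intro attach ground X) auto
    then show ?thesis using D by (simp add: product rank_rim empty edges)
  qed
  have "(\<Sum>i\<in>UNIV. \<phi> (A (i+1) \<union> A (i+2) \<union> B (i+1) \<union> B (i+2) \<union> C i))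
      = t (star (\<lambda>i. A (i+1) \<union> A (i+2) \<union> B (i+1) \<union> B (i+2) \<union> C i))"
    unfolding star_def using A B C by (subst star_sum) auto
  also have "\<dots> \<le> t ((Q G \<union> R A) \<union> R B)"
    by (intro mono Un_least ground A B G) (auto simp: defs)
  also have "\<dots> \<le> t (Q G \<union> R A) + (t (R B) - t (P B))"
    by (intro attach Un_least ground A B G) (auto simp: defs)
  also have "t (Q G \<union> R A) \<le> t (Q G) + (t (R A) - t (P A))"
    by (intro attach ground A G) (auto simp: defs)
  finally have "(\<Sum>i\<in>UNIV. \<phi> (A (i+1) \<union> A (i+2) \<union> B (i+1) \<union> B (i+2) \<union> C i))
      \<le> t (Q G) + (t (R A) - t (P A)) + (t (R B) - t (P B))"
    by simp
  moreover have "t (P G) + t (star C) \<le> t (P A) + t (P B)"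
  proof -
    have "t (P A \<union> P B) \<le> t (P A) + (t (P B) - t (star C))"
      by (intro attach ground A B) (auto simp: P_def)
    moreover have "P A \<union> P B = P G" by (auto simp: defs)
    ultimately show ?thesis by simp
  qed
  moreover have "t (star C) = (\<Sum>i\<in>UNIV. \<phi> (C i))"
    unfolding star_def using C by (rule star_sum)
  moreover have "\<phi> (C 2) + \<phi> (G 3 \<union> C 1) + \<phi> (G 1 \<union> G 2) + (\<phi> (C 1 \<union> C 2 \<union> C 3) - \<phi> (C 1 \<union> C 2)) \<le> t (P G)"
    unfolding P_def star_def rim_def using C G by (rule wheel_lower_bound)
  moreover have "G 1 \<union> G 2 = A 1 \<union> A 2 \<union> B 1 \<union> B 2" by (auto simp: G_def)
  moreover have "A i \<subseteq> G i" "B i \<subseteq> G i" for i by (auto simp: G_def)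
  ultimately show ?thesis
    using QG_le_QX[of A] QG_le_QX[of B] QX_le_PX[of A, OF A] QX_le_PX[of B, OF B] R_le[of A, OF A] R_le[of B, OF B]
    unfolding desargues_ineq_def
    by (simp add: G_def sum.distrib sum_subtractf sum_distrib_left[symmetric])
qed

end

section \<open>Bounds on matroid ranks\<close>

lemma card_le_matroid_rank:
  assumes "finite E" "\<I> \<subseteq> Pow E" "J \<in> \<I>" "J \<subseteq> X"
  shows "card J \<le> matroid_rank \<I> X"
proof -
  have "finite {J \<in> \<I>. J \<subseteq> X}"
    by (rule finite_subset[of _ "Pow E"]) (use assms(1,2) in auto)
  then show ?thesis unfolding matroid_rank_def using assms(3,4) by (intro Max_ge) auto
qed

lemma matroid_rank_le:
  assumes "finite E" "\<I> \<subseteq> Pow E" "{} \<in> \<I>" "\<And>J. J \<in> \<I> \<Longrightarrow> J \<subseteq> X \<Longrightarrow> card J \<le> k"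
  shows "matroid_rank \<I> X \<le> k"
proof -
  have "finite {J \<in> \<I>. J \<subseteq> X}"
    by (rule finite_subset[of _ "Pow E"]) (use assms(1,2) in auto)
  moreover have "{} \<in> {J \<in> \<I>. J \<subseteq> X}" using assms(3) by simp
  ultimately show ?thesis
    unfolding matroid_rank_def by (intro Max.boundedI) (auto intro: assms(4))
qed

section \<open>The cycle matroid of the complete graph on four vertices\<close>

text \<open>On a cycle, both neighbours of a vertex are distinct, so every vertex lies on two of its edges.\<close>

lemma acyclic_insert_leaf:
  assumes F: "\<nexists>vs. is_cycle F vs" and v: "\<And>e. e \<in> F \<Longrightarrow> v \<notin> e" and "v \<noteq> w"
  shows "\<nexists>vs. is_cycle (insert {v, w} F) vs"
proof
  assume "\<exists>vs. is_cycle (insert {v, w} F) vs"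
  then obtain vs where n: "3 \<le> length vs" and d: "distinct vs"
    and e: "\<And>i. i < length vs \<Longrightarrow> {vs ! i, vs ! ((i + 1) mod length vs)} \<in> insert {v, w} F"
    unfolding is_cycle_def by blast
  let ?n = "length vs"
  show False
  proof (cases "v \<in> set vs")
    case False
    have "{vs ! i, vs ! ((i + 1) mod ?n)} \<in> F" if i: "i < ?n" for i
    proof -
      have "(i + 1) mod ?n < ?n" using n by (intro mod_less_divisor) linarith
      then have "vs ! i \<noteq> v" "vs ! ((i + 1) mod ?n) \<noteq> v" using False i nth_mem by metis+
      then show ?thesis using e[OF i] by (metis insertE insertI1 singletonD)
    qed
    then show False using F n d by (auto simp: is_cycle_def)
  next
    case True
    then obtain i where i: "i < ?n" and vi: "vs ! i = v" by (auto simp: in_set_conv_nth)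
    have n': "Suc (?n - Suc 0) = ?n" using n by simp
    define j where "j = (if i = 0 then ?n - 1 else i - 1)"
    define k where "k = (if i = ?n - 1 then 0 else i + 1)"
    have jk: "j < ?n" "k < ?n" "j \<noteq> k" "(j + 1) mod ?n = i" "(i + 1) mod ?n = k"
      using i n by (auto simp: j_def k_def n')
    have "{v, vs ! k} = {v, w}" "{vs ! j, v} = {v, w}"
      using e[OF i] e[OF jk(1)] v vi jk(4,5) by auto
    then have "vs ! k = vs ! j" by (metis doubleton_eq_iff)
    then show False using d jk(1-3) by (simp add: nth_eq_iff_index_eq)
  qed
qed

lemma acyclic_empty: "\<nexists>vs. is_cycle {} vs"
  by (auto simp: is_cycle_def intro!: exI[of _ 0])

lemma is_cycle_3:
  "is_cycle F [a, b, c] \<longleftrightarrow> distinct [a, b, c] \<and> {{a, b}, {b, c}, {c, a}} \<subseteq> F"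
  by (auto simp: is_cycle_def All_less_Suc)

lemma is_cycle_4:
  "is_cycle F [a, b, c, d] \<longleftrightarrow>
    distinct [a, b, c, d] \<and> {{a, b}, {b, c}, {c, d}, {d, a}} \<subseteq> F"
  by (auto simp: is_cycle_def All_less_Suc)

text \<open>The lower bounds on ranks come from explicit forests, built by adding one leaf at a time. The rank
  is at most three because four edges of \<open>K\<^sub>4\<close> contain one of its four triangles unless the two
  other edges are opposite, in which case the four form a cycle.\<close>

lemma k4_tensor_of_complete_graph:
  fixes V :: "'v set"
  assumes V: "card V = 4"
    and tp: "is_tensor_product (complete_graph_edges V)
               (\<lambda>X. real (matroid_rank (graphic_matroid (complete_graph_edges V)) X)) S \<phi> t"
  shows "\<exists>s q. k4_tensor (complete_graph_edges V)
               (\<lambda>X. real (matroid_rank (graphic_matroid (complete_graph_edges V)) X)) S \<phi> t s q"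
proof -
  obtain w x y z where Veq: "V = {w, x, y, z}" and dist: "distinct [w, x, y, z]"
    using V by (auto simp: card_Suc_eq numeral_eq_Suc)
  define v :: "3 \<Rightarrow> 'v" where "v = (\<lambda>i. if i = 1 then x else if i = 2 then y else z)"
  have inj: "v i = v j \<longleftrightarrow> i = j" for i j
    using dist exhaust_3[of i] exhaust_3[of j] by (auto simp: v_def)
  have vw: "v i \<noteq> w" for i using dist by (auto simp: v_def)
  have wv: "w \<noteq> v i" for i using vw[of i] by blast
  define s where "s = (\<lambda>i. {w, v i})"
  define q where "q = (\<lambda>i. {v (i+1), v (i+2)})"
  let ?E = "complete_graph_edges V"
  define M where "M = graphic_matroid ?E"
  have s: "s 1 = {w, v 1}" "s 2 = {w, v 2}" "s 3 = {w, v 3}"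
    and q: "q 1 = {v 2, v 3}" "q 2 = {v 3, v 1}" "q 3 = {v 1, v 2}"
    by (simp_all add: s_def q_def mod_3_numerals)
  have E: "?E = {s 1, s 2, s 3, q 1, q 2, q 3}"
  proof -
    have V': "V = {w, v 1, v 2, v 3}" by (simp add: Veq v_def)
    have "e \<in> {s 1, s 2, s 3, q 1, q 2, q 3}" if e: "e \<in> ?E" for e
    proof -
      obtain a b where ab: "e = {a, b}" "a \<noteq> b" and V: "a \<in> V" "b \<in> V"
        using e by (auto simp: complete_graph_edges_def card_2_iff)
      show ?thesis
        using V ab(2) unfolding V' ab(1) s q
        by (elim insertE emptyE) (simp_all add: insert_commute)
    qed
    moreover have "{a, b} \<in> ?E" if "a \<in> V" "b \<in> V" "a \<noteq> b" for a b
      using that by (simp add: complete_graph_edges_def)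
    then have "{s 1, s 2, s 3, q 1, q 2, q 3} \<subseteq> ?E"
      by (simp add: s q V' inj wv)
    ultimately show ?thesis by blast
  qed
  have wq: "w \<notin> q i" for i by (simp add: q_def wv)
  have sq: "s i \<noteq> q j" for i j using vw by (auto simp: s_def q_def doubleton_eq_iff)
  have s_inj: "s i = s j \<longleftrightarrow> i = j" for i j using vw by (auto simp: s_def doubleton_eq_iff inj)
  have q_inj: "q i = q j \<longleftrightarrow> i = j" for i j
    using exhaust_3[of i] exhaust_3[of j] by (auto simp: q doubleton_eq_iff inj)
  have edge: "s i \<in> ?E" "q i \<in> ?E" for i using exhaust_3[of i] by (auto simp: E)
  have M: "M \<subseteq> Pow ?E" "{} \<in> M"
    using acyclic_empty by (auto simp: M_def graphic_matroid_def)
  have finE: "finite ?E" unfolding E by simp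
  have forest: "F \<in> M \<longleftrightarrow> F \<subseteq> ?E \<and> (\<nexists>vs. is_cycle F vs)" for F
    by (simp add: M_def graphic_matroid_def)
  have leaf: "insert {a, b} F \<in> M" if "F \<in> M" "{a, b} \<in> ?E" "\<And>e. e \<in> F \<Longrightarrow> a \<notin> e" for a b F
  proof -
    have "a \<noteq> b" using that(2) by (auto simp: complete_graph_edges_def)
    then show ?thesis using that acyclic_insert_leaf[of F a b] by (simp add: forest)
  qed
  have one: "{g} \<in> M" if g: "g \<in> ?E" for g
  proof -
    obtain a b where "g = {a, b}" using g by (auto simp: complete_graph_edges_def card_2_iff)
    then show ?thesis using leaf[OF M(2)] g by simp
  qed
  have two: "{g, h} \<in> M" if gh: "g \<in> ?E" "h \<in> ?E" "g \<noteq> h" for g h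
  proof -
    have c: "card g = 2" "card h = 2" using gh by (simp_all add: complete_graph_edges_def)
    then have "\<not> g \<subseteq> h" using gh(3) by (metis card.infinite card_subset_eq zero_neq_numeral)
    then obtain a where a: "a \<in> g" "a \<notin> h" by blast
    then obtain b where "g = {a, b}" using c(1) by (auto simp: card_2_iff)
    then show ?thesis using leaf[OF one[OF gh(2)], of a b] gh(1) a by simp
  qed
  have star: "range s \<in> M"
  proof -
    have "insert {v 1, w} {s 2, s 3} \<in> M"
      using edge(1)[of 1] vw[of 1]
      by (intro leaf two edge) (auto simp: s s_inj inj insert_commute doubleton_eq_iff)
    then show ?thesis by (simp add: UNIV_3 s insert_commute)
  qed
  have path: "{s i, q j, q k} \<in> M" if "j \<noteq> k" for i j k
  proof -
    have "insert {w, v i} {q j, q k} \<in> M"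
      using edge(1)[of i] that wq by (intro leaf two edge) (auto simp: s_def q_inj)
    then show ?thesis by (simp add: s_def)
  qed
  have triangle: "\<not> {{a, b}, {b, c}, {c, a}} \<subseteq> J" if "J \<in> M" "distinct [a, b, c]" for a b c J
  proof
    assume "{{a, b}, {b, c}, {c, a}} \<subseteq> J"
    then have "is_cycle J [a, b, c]"
      using that(2) by (simp add: is_cycle_3)
    then show False using that(1) by (auto simp: forest)
  qed
  have quad: "\<not> {{a, b}, {b, c}, {c, d}, {d, a}} \<subseteq> J"
    if "J \<in> M" "distinct [a, b, c, d]" for a b c d J
  proof
    assume "{{a, b}, {b, c}, {c, d}, {d, a}} \<subseteq> J"
    then have "is_cycle J [a, b, c, d]"
      using that(2) by (simp add: is_cycle_4)
    then show False using that(1) by (auto simp: forest)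
  qed
  have card_le_3: "card J \<le> 3" if J: "J \<in> M" for J
  proof -
    have no_triangle: "\<not> {s 2, s 3, q 1} \<subseteq> J" "\<not> {s 1, s 3, q 2} \<subseteq> J" "\<not> {s 1, s 2, q 3} \<subseteq> J"
      "\<not> {q 1, q 2, q 3} \<subseteq> J"
      using triangle[OF J, of w "v 2" "v 3"] triangle[OF J, of w "v 3" "v 1"]
        triangle[OF J, of w "v 1" "v 2"] triangle[OF J, of "v 1" "v 2" "v 3"]
      by (auto simp: s q inj insert_commute wv)
    have no_quad: "\<not> {s 1, s 2, q 1, q 2} \<subseteq> J" "\<not> {s 1, s 3, q 1, q 3} \<subseteq> J"
      "\<not> {s 2, s 3, q 2, q 3} \<subseteq> J"
      using quad[OF J, of w "v 1" "v 3" "v 2"] quad[OF J, of w "v 1" "v 2" "v 3"]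
        quad[OF J, of w "v 2" "v 1" "v 3"]
      by (auto simp: s q inj insert_commute wv)
    have card_J: "card J = b (s 1) + b (s 2) + b (s 3) + b (q 1) + b (q 2) + b (q 3)"
      if b: "b = (\<lambda>g. if g \<in> J then 1 else 0)" for b :: "'v set \<Rightarrow> nat"
    proof -
      have "?E \<inter> J = J" using J M(1) by blast
      then have "card J = sum b ?E"
        unfolding b using sum.inter_restrict[OF finE, of "\<lambda>_. 1::nat" J] by simp
      then show ?thesis unfolding E by (simp add: sq s_inj q_inj)
    qed
    from card_J[OF refl] have "card J \<le> 3 \<or> {s 2, s 3, q 1} \<subseteq> J \<or> {s 1, s 3, q 2} \<subseteq> J
        \<or> {s 1, s 2, q 3} \<subseteq> J \<or> {q 1, q 2, q 3} \<subseteq> J \<or> {s 1, s 2, q 1, q 2} \<subseteq> J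
        \<or> {s 1, s 3, q 1, q 3} \<subseteq> J \<or> {s 2, s 3, q 2, q 3} \<subseteq> J"
      by (cases "s 1 \<in> J"; cases "s 2 \<in> J"; cases "s 3 \<in> J";
          cases "q 1 \<in> J"; cases "q 2 \<in> J"; cases "q 3 \<in> J") simp_all
    then show ?thesis using no_triangle no_quad by blast
  qed
  have rank_ge: "card J \<le> matroid_rank M X" if "J \<in> M" "J \<subseteq> X" for J X
    using card_le_matroid_rank[OF finE M(1) that] .
  have rank_le: "matroid_rank M X \<le> k" if "\<And>J. J \<in> M \<Longrightarrow> J \<subseteq> X \<Longrightarrow> card J \<le> k" for X k
    using matroid_rank_le[OF finE M] that by blast
  have rank_le_card: "matroid_rank M X \<le> card X" if "finite X" for X
    using that by (intro rank_le card_mono)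
  have rank_2: "matroid_rank M {g, h} = 2" if "g \<in> ?E" "h \<in> ?E" "g \<noteq> h" for g h
    using rank_ge[OF two[OF that], of "{g, h}"] rank_le_card[of "{g, h}"] that by simp
  have rank_3: "matroid_rank M X = 3" if "J \<in> M" "J \<subseteq> X" "card J = 3" for J X
    using rank_ge[OF that(1,2)] rank_le[of X 3] card_le_3 that(3) by (simp add: le_antisym)
  have rank_triangle: "matroid_rank M {g, h, k} = 2"
    if ghk: "g \<in> ?E" "h \<in> ?E" "g \<noteq> h" "{g, h, k} \<notin> M" for g h k
  proof (rule antisym)
    show "matroid_rank M {g, h, k} \<le> 2"
    proof (rule rank_le)
      fix J assume J: "J \<in> M" "J \<subseteq> {g, h, k}"
      then have "J \<subset> {g, h, k}" using ghk by blast
      then have "card J < card {g, h, k}" by (intro psubset_card_mono) auto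
      also have "\<dots> \<le> 3" by (simp add: card_insert_if)
      finally show "card J \<le> 2" by simp
    qed
    show "2 \<le> matroid_rank M {g, h, k}"
      using rank_ge[OF two[OF ghk(1-3)], of "{g, h, k}"] ghk(3) by simp
  qed
  have sub: "{q 1, q 2, q 3} \<notin> M" "{s (i+1), s (i+2), q i} \<notin> M" for i
    using triangle[of "{q 1, q 2, q 3}" "v 1" "v 2" "v 3"]
      triangle[of "{s (i+1), s (i+2), q i}" w "v (i+1)" "v (i+2)"]
    by (auto simp: q s_def q_def inj insert_commute wv)
  have "k4_tensor ?E (\<lambda>X. real (matroid_rank M X)) S \<phi> t s q"
  proof
    show "is_tensor_product ?E (\<lambda>X. real (matroid_rank M X)) S \<phi> t"
      using tp by (simp add: M_def)
    show "?E = range s \<union> range q" by (auto simp: E UNIV_3)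
    show "inj s" "inj q" by (auto intro: injI simp: s_inj q_inj)
    show "s i \<noteq> q j" for i j by (rule sq)
    show "real (matroid_rank M {g}) = 1" if "g \<in> ?E" for g
      using rank_ge[OF one[OF that], of "{g}"] rank_le_card[of "{g}"] by simp
    show "real (matroid_rank M {g, h}) = 2" if "g \<in> ?E" "h \<in> ?E" "g \<noteq> h" for g h
      using rank_2 that by simp
    show "real (matroid_rank M (range q)) = 2"
      using rank_triangle[of "q 1" "q 2" "q 3"] sub(1) by (simp add: UNIV_3 edge q_inj)
    show "real (matroid_rank M {s (i+1), s (i+2), q i}) = 2" for i
      using rank_triangle[of "s (i+1)" "s (i+2)" "q i"] sub(2) by (simp add: edge s_inj)
    show "real (matroid_rank M (range s)) = 3"
    proof -
      have "card (range s) = 3" by (subst card_image) (auto intro: injI simp: s_inj)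
      then show ?thesis using rank_3[OF star, of "range s"] by simp
    qed
    show "real (matroid_rank M X) = 3" if "j \<noteq> k" "{s i, q j, q k} \<subseteq> X" for i j k X
      using rank_3[OF path that(2)] that(1) by (simp add: sq q_inj)
  qed
  then show ?thesis unfolding M_def by blast
qed

section \<open>Three points on no common line\<close>

text \<open>If \<open>w\<close> were dependent on \<open>u\<close> and \<open>v\<close>, then the closure of \<open>{u, v}\<close> would be a flat of rank two with
  at least three points, and these are the prescribed lines only.\<close>

lemma non_collinear_independent:
  assumes M: "non_Desargues_matroid \<I>" and uvw: "u \<noteq> v" "w \<noteq> u" "w \<noteq> v"
    and "\<And>L. L \<in> nd_lines \<Longrightarrow> \<not> {u, v, w} \<subseteq> L"
  shows "{u, v, w} \<in> \<I>"
proof (rule ccontr)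
  assume dep: "{u, v, w} \<notin> \<I>"
  have mat: "matroid UNIV \<I>" and simple: "matroid_simple UNIV \<I>"
    and lines: "{L. matroid_flat UNIV \<I> L \<and> matroid_rank \<I> L = 2 \<and> 3 \<le> card L} = nd_lines"
    using M by (auto simp: non_Desargues_matroid_def)
  have fin: "finite (X :: nd_point set)" for X
    by (rule finite_subset[OF subset_UNIV finite_nd_points])
  have ind: "finite (UNIV :: nd_point set)" "\<I> \<subseteq> Pow UNIV" "{} \<in> \<I>"
    using mat by (simp_all add: matroid_def)
  note ge = card_le_matroid_rank[OF ind(1,2)] and le = matroid_rank_le[OF ind]
  have uv: "{u, v} \<in> \<I>" using simple by (simp add: matroid_simple_def)
  \<comment> \<open>\<open>F\<close> is the closure of \<open>{u, v}\<close>.\<close>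
  define F where "F = {e. {u, v, e} \<notin> \<I>} \<union> {u, v}"
  have F: "{u, v, w} \<subseteq> F" using dep by (auto simp: F_def)
  have "matroid_rank \<I> F \<le> 2"
  proof (rule le, rule ccontr)
    fix J assume J: "J \<in> \<I>" "J \<subseteq> F" "\<not> card J \<le> 2"
    then have "card {u, v} < card J" using uvw by simp
    then obtain e where "e \<in> J - {u, v}" "insert e {u, v} \<in> \<I>"
      using mat uv J(1) unfolding matroid_def by blast
    then show False using J(2) by (auto simp: F_def insert_commute)
  qed
  moreover have "2 \<le> matroid_rank \<I> F" using ge[OF uv, of F] F uvw by simp
  ultimately have rank: "matroid_rank \<I> F = 2" by simp
  have "2 < matroid_rank \<I> (insert e F)" if "e \<notin> F" for e
  proof -
    have "{u, v, e} \<in> \<I>" "card {u, v, e} = 3" using that uvw by (auto simp: F_def)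
    then show ?thesis using ge[of "{u, v, e}" "insert e F"] F by simp
  qed
  then have "matroid_flat UNIV \<I> F" by (simp add: matroid_flat_def rank)
  moreover have "3 \<le> card F" using card_mono[OF fin F] uvw by simp
  ultimately have "F \<in> nd_lines" using rank lines by blast
  then show False using assms(5) F by blast
qed

lemma non_Desargues_violates:
  assumes M: "non_Desargues_matroid \<I>"
  shows "\<not> desargues_ineq (\<lambda>X. real (matroid_rank \<I> X))
                (\<lambda>i. {Pt_a i}) (\<lambda>i. {Pt_b i}) (\<lambda>i. {Pt_c i}) {Pt_d}"
proof -
  let ?r = "matroid_rank \<I>"
  have simple: "matroid_simple UNIV \<I>"
    and lines: "{L. matroid_flat UNIV \<I> L \<and> ?r L = 2 \<and> 3 \<le> card L} = nd_lines"
    using M by (auto simp: non_Desargues_matroid_def)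
  have ind: "finite (UNIV :: nd_point set)" "\<I> \<subseteq> Pow UNIV" "{} \<in> \<I>"
    using M by (simp_all add: non_Desargues_matroid_def matroid_def)
  note ge = card_le_matroid_rank[OF ind(1,2)]
  have le: "?r X \<le> card X" for X
    using finite_subset[OF subset_UNIV ind(1)] by (intro matroid_rank_le[OF ind] card_mono)
  have line: "?r L = 2" if "L \<in> nd_lines" for L using that lines by blast
  have two: "2 \<le> ?r {u, v}" if "u \<noteq> v" for u v
    using ge[of "{u, v}" "{u, v}"] simple that by (simp add: matroid_simple_def)
  have one: "1 \<le> ?r {u}" for u
  proof -
    have "{u, u} \<in> \<I>" using simple unfolding matroid_simple_def by blast
    then show ?thesis using ge[of "{u}" "{u}"] by simp
  qed
  have three: "3 \<le> ?r X"
    if "{u, v, w} \<subseteq> X" "u \<noteq> v" "w \<noteq> u" "w \<noteq> v" "\<forall>L\<in>nd_lines. \<not> {u, v, w} \<subseteq> L" for u v w X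
    using ge[OF non_collinear_independent[OF M that(2,3,4)] that(1)] that(2-5) by simp
  have l: "?r {Pt_a i, Pt_b i, Pt_d} \<le> 2" "?r {Pt_a (i+1), Pt_a (i+2), Pt_c i} \<le> 2"
    "?r {Pt_b (i+1), Pt_b (i+2), Pt_c i} \<le> 2" for i
    using exhaust_3[of i]
    by (auto intro!: eq_imp_le line simp: nd_lines_def insert_commute mod_3_numerals)
  have u: "3 \<le> ?r {Pt_a (i+1), Pt_a (i+2), Pt_b (i+1), Pt_b (i+2), Pt_c i}" for i
    by (rule three[of "Pt_a (i+1)" "Pt_a (i+2)" "Pt_b (i+1)"]) (auto simp: nd_lines_def)
  have "3 \<le> ?r {Pt_a 3, Pt_b 3, Pt_c 1}"
    by (rule three[of "Pt_a 3" "Pt_b 3" "Pt_c 1"]) (auto simp: nd_lines_def)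
  moreover have "3 \<le> ?r {Pt_a 1, Pt_a 2, Pt_b 1, Pt_b 2}"
    by (rule three[of "Pt_a 1" "Pt_a 2" "Pt_b 1"]) (auto simp: nd_lines_def)
  moreover have "3 \<le> ?r {Pt_c 1, Pt_c 2, Pt_c 3}"
    by (rule three[of "Pt_c 1" "Pt_c 2" "Pt_c 3"]) (auto simp: nd_lines_def)
  moreover have "?r {Pt_c 1, Pt_c 2} \<le> 2" "?r {Pt_d} \<le> 1"
    using le[of "{Pt_c 1, Pt_c 2}"] le[of "{Pt_d}"] by auto
  moreover note u[of 1] u[of 2] u[of 3] l[of 1] l[of 2] l[of 3]
    two[of "Pt_a 1" Pt_d] two[of "Pt_a 2" Pt_d] two[of "Pt_a 3" Pt_d]
    two[of "Pt_b 1" Pt_d] two[of "Pt_b 2" Pt_d] two[of "Pt_b 3" Pt_d]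
    one[of "Pt_c 1"] one[of "Pt_c 2"] one[of "Pt_c 3"]
  ultimately show ?thesis
    unfolding desargues_ineq_def
    by (simp add: sum_3 mod_3_numerals insert_commute)
qed

theorem theorem7p9:
  shows "(\<forall>(V :: 'v set) (S\<^sub>2 :: 'a set) (\<phi>\<^sub>1 :: 'v set set \<Rightarrow> real) (\<phi>\<^sub>2 :: 'a set \<Rightarrow> real).
            card V = 4 \<longrightarrow>
            \<phi>\<^sub>1 = (\<lambda>X. real (matroid_rank (graphic_matroid (complete_graph_edges V)) X)) \<longrightarrow>
            polymatroid_on S\<^sub>2 \<phi>\<^sub>2 \<longrightarrow>
            (\<exists>\<phi>. is_tensor_product (complete_graph_edges V) \<phi>\<^sub>1 S\<^sub>2 \<phi>\<^sub>2 \<phi>) \<longrightarrow>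
            (\<forall>A B C D. (\<forall>i. A i \<subseteq> S\<^sub>2) \<and> (\<forall>i. B i \<subseteq> S\<^sub>2) \<and> (\<forall>i. C i \<subseteq> S\<^sub>2) \<and> D \<subseteq> S\<^sub>2 \<longrightarrow>
               desargues_ineq \<phi>\<^sub>2 A B C D))
       \<and> (\<forall>\<I>. non_Desargues_matroid \<I> \<longrightarrow>
            \<not> desargues_ineq (\<lambda>X. real (matroid_rank \<I> X))
                (\<lambda>i. {Pt_a i}) (\<lambda>i. {Pt_b i}) (\<lambda>i. {Pt_c i}) {Pt_d})"
proof (intro conjI allI impI)
  fix V :: "'v set" and S\<^sub>2 :: "'a set" and \<phi>\<^sub>1 \<phi>\<^sub>2
    and A B C :: "3 \<Rightarrow> 'a set" and D
  assume V: "card V = 4" and rank: "\<phi>\<^sub>1 = (\<lambda>X. real (matroid_rank (graphic_matroid (complete_graph_edges V)) X))"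
    and tp: "\<exists>\<phi>. is_tensor_product (complete_graph_edges V) \<phi>\<^sub>1 S\<^sub>2 \<phi>\<^sub>2 \<phi>"
    and sub: "(\<forall>i. A i \<subseteq> S\<^sub>2) \<and> (\<forall>i. B i \<subseteq> S\<^sub>2) \<and> (\<forall>i. C i \<subseteq> S\<^sub>2) \<and> D \<subseteq> S\<^sub>2"
  from tp obtain \<phi> where "is_tensor_product (complete_graph_edges V) \<phi>\<^sub>1 S\<^sub>2 \<phi>\<^sub>2 \<phi>" ..
  then obtain s q where "k4_tensor (complete_graph_edges V) \<phi>\<^sub>1 S\<^sub>2 \<phi>\<^sub>2 \<phi> s q"
    using k4_tensor_of_complete_graph[OF V] unfolding rank by blast
  then show "desargues_ineq \<phi>\<^sub>2 A B C D" by (rule k4_tensor.desargues) (use sub in auto)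
qed (rule non_Desargues_violates)

end
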